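(* For every integer $a\geq 3$ and every integer $m\geq a^2-a+1$, the 2-color Rado number of the equation $x_1+x_2+\cdots+x_{m-1}=ax_m$ equals $C(m,a)=\left\lceil\frac{m-1}{a}\left\lceil\frac{m-1}{a}\right\rceil\right\rceil$.
   Context: For integers $m\ge 3$ and $a\ge 1$, the 2-color Rado number of $x_1+\cdots+x_{m-1}=ax_m$ is the least positive integer $n$ such that for every coloring of $[n]=\{1,\dots,n\}$ with two colors there exist $x_1,\dots,x_m\in[n]$ (not necessarily distinct), all of the same color, satisfying the equation. *)

theory Defs
  imports Complex_Main
begin

definition has_mono_solution :: "nat \<Rightarrow> nat \<Rightarrow> nat \<Rightarrow> (nat \<Rightarrow> bool) \<Rightarrow> bool" where
  "has_mono_solution m a n col \<longleftrightarrow>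
     (\<exists>x :: nat \<Rightarrow> nat.
        (\<forall>i \<in> {1..m}. x i \<in> {1..n}) \<and>
        (\<forall>i \<in> {1..m}. \<forall>j \<in> {1..m}. col (x i) = col (x j)) \<and>
        (\<Sum>i = 1..m - 1. x i) = a * x m)"

(* A 2-coloring of {1..n} is represented by a function nat => bool; its values
   outside {1..n} play no role in has_mono_solution m a n. *)
definition forces_solution :: "nat \<Rightarrow> nat \<Rightarrow> nat \<Rightarrow> bool" where
  "forces_solution m a n \<longleftrightarrow> (\<forall>col :: nat \<Rightarrow> bool. has_mono_solution m a n col)"

(* A relation rather than a LEAST term, so that the existence of some n with the
   forcing property is part of the claim that N is the Rado number. *)
definition is_rado_number :: "nat \<Rightarrow> nat \<Rightarrow> nat \<Rightarrow> bool" where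
  "is_rado_number m a N \<longleftrightarrow>
     N \<ge> 1 \<and> forces_solution m a N \<and> (\<forall>n \<ge> 1. forces_solution m a n \<longrightarrow> N \<le> n)"

(* For m, a >= 1 the ceiling is nonnegative, so the conversion to nat loses nothing. *)
definition rado_C :: "nat \<Rightarrow> nat \<Rightarrow> nat" where
  "rado_C m a =
     nat \<lceil>(real m - 1) / real a * real_of_int \<lceil>(real m - 1) / real a\<rceil>\<rceil>"

end

(* Write k = m - 1, c = ceil (k / a) and C = ceil (k c / a). Colouring the numbers below c red and
   the others blue shows that the Rado number is at least C.

   Conversely, let 1 be red in a colouring of {1..C}. A number y has the wrong colour as soon as
   i y is a sum of k - a + i numbers of its own colour for some i <= a: add a - i copies of y.
   If 2 and 3 are blue, y = k - a + 1 can be neither red (i = 1) nor blue (i = 3).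
   If 2 and 4 are blue and 3 is red, this happens for y = 2 c, where for odd k the red sum
   (of ones and threes) uses i = a - 1 for parity reasons.
   If 2 is blue and 3 and 4 are red, it happens for y = k - a + 2 (i = 2 for both colours), unless
   k = a (a - 1), when this y may exceed C and y = 2 c takes its place.
   If 2 is red, the blue numbers from c on form too long an interval. *)
theory Submission
  imports Defs
begin

section \<open>Sums of a prescribed number of elements of a set, with repetition\<close>

definition k_sum :: "nat set \<Rightarrow> nat \<Rightarrow> nat \<Rightarrow> bool" where
  "k_sum S k D \<longleftrightarrow> (\<exists>xs. length xs = k \<and> set xs \<subseteq> S \<and> sum_list xs = D)"

lemma k_sum_add:
  assumes "k_sum S i D" and "k_sum S j E"
  shows "k_sum S (i + j) (D + E)"
proof -
  obtain xs ys where "length xs = i" "set xs \<subseteq> S" "sum_list xs = D"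
    "length ys = j" "set ys \<subseteq> S" "sum_list ys = E"
    using assms unfolding k_sum_def by blast
  then have "length (xs @ ys) = i + j \<and> set (xs @ ys) \<subseteq> S \<and> sum_list (xs @ ys) = D + E"
    by simp
  then show ?thesis unfolding k_sum_def by blast
qed

lemma k_sum_replicate: "x \<in> S \<Longrightarrow> k_sum S j (j * x)"
  unfolding k_sum_def
  by (rule exI[of _ "replicate j x"]) (auto simp: sum_list_replicate)

lemma k_sum_two_values:
  assumes "p \<in> S" and "p + d \<in> S" and "i \<le> j"
  shows "k_sum S j (j * p + i * d)"
proof -
  have "k_sum S ((j - i) + i) ((j - i) * p + i * (p + d))"
    by (intro k_sum_add k_sum_replicate assms)
  moreover have "(j - i) * p + i * (p + d) = j * p + i * d"
    using le_Suc_ex[OF assms(3)] by (auto simp: algebra_simps)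
  ultimately show ?thesis using assms(3) by simp
qed

lemma k_sum_interval:
  assumes "{p..q} \<subseteq> S" and "j * p \<le> D" and "D \<le> j * q"
  shows "k_sum S j D"
  using assms(2,3)
proof (induction j arbitrary: D)
  case 0
  then show ?case using k_sum_def by auto
next
  case (Suc j)
  have "Suc j * p \<le> Suc j * q" using Suc.prems by linarith
  then have pq: "p \<le> q" by (simp only: Suc_mult_le_cancel1)
  then have jpq: "j * p \<le> j * q" by simp
  \<comment> \<open>The least summand \<open>x \<ge> p\<close> that leaves a remainder of at most
    \<open>j * q\<close>.\<close>
  define x where "x = max p (D - j * q)"
  have x: "p \<le> x" "x \<le> q" "x \<le> D" "j * p \<le> D - x" "D - x \<le> j * q"
    using Suc.prems pq jpq unfolding x_def by (cases "D \<le> j * q"; auto simp: max_def)+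
  then have "k_sum S j (D - x)" using Suc.IH by blast
  moreover have "k_sum S 1 (1 * x)"
    using x assms(1) by (intro k_sum_replicate) auto
  ultimately have "k_sum S (j + 1) (D - x + 1 * x)" by (rule k_sum_add)
  then show ?case using x by simp
qed

lemma k_sum_self:
  assumes "y \<in> S" and "i \<le> a" and "a \<le> k" and "k_sum S (k - a + i) (i * y)"
  shows "k_sum S k (a * y)"
proof -
  have "k_sum S ((k - a + i) + (a - i)) (i * y + (a - i) * y)"
    using assms by (intro k_sum_add k_sum_replicate)
  moreover have "i * y + (a - i) * y = a * y"
    using assms(2) by (metis distrib_right le_add_diff_inverse)
  ultimately show ?thesis using assms by simp
qed

lemma has_mono_solutionI:
  assumes "m \<ge> 1" and "k_sum S (m - 1) (a * y)" and "y \<in> S" and "S \<subseteq> {1..n}"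
    and "\<And>x. x \<in> S \<Longrightarrow> col x = b"
  shows "has_mono_solution m a n col"
proof -
  obtain xs where xs: "length xs = m - 1" "set xs \<subseteq> S" "sum_list xs = a * y"
    using assms(2) unfolding k_sum_def by blast
  define x where "x i = (if i < m then xs ! (i - 1) else y)" for i
  have S: "x i \<in> S" if "i \<in> {1..m}" for i
    using that xs(1,2) assms(3) unfolding x_def by (auto intro: subsetD[OF _ nth_mem])
  have "(\<Sum>i = 1..m - 1. x i) = (\<Sum>i = 1..m - 1. xs ! (i - 1))"
    by (rule sum.cong) (auto simp: x_def)
  also have "\<dots> = (\<Sum>i = 0..<m - 1. xs ! i)"
    by (rule sum.reindex_bij_witness[of _ Suc "\<lambda>i. i - 1"]) auto
  also have "\<dots> = a * x m"
    using xs by (simp add: sum_list_sum_nth x_def)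
  finally have "(\<Sum>i = 1..m - 1. x i) = a * x m" .
  moreover have "\<forall>i\<in>{1..m}. x i \<in> {1..n}" using S assms(4) by blast
  moreover have "\<forall>i\<in>{1..m}. \<forall>j\<in>{1..m}. col (x i) = col (x j)" using S assms(5) by simp
  ultimately show ?thesis unfolding has_mono_solution_def by blast
qed

text \<open>Because \<open>2 * L \<le> U\<close>, for \<open>j \<ge> 1\<close> the intervals from
  \<open>j * L\<close> to \<open>j * U\<close> and from \<open>(j + 1) * L\<close> to
  \<open>(j + 1) * U\<close> meet, so no gaps remain above \<open>L\<close>.\<close>

lemma multiple_between:
  fixes L U D k :: nat
  assumes "2 * L \<le> U" and "L \<le> D" and "D \<le> k * U"
  obtains j where "j \<le> k" and "j * L \<le> D" and "D \<le> j * U"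
proof -
  define j where "j = (LEAST j. D \<le> j * U)"
  have jU: "D \<le> j * U" unfolding j_def using assms(3) by (rule LeastI)
  have jk: "j \<le> k" unfolding j_def using assms(3) by (rule Least_le)
  have "j * L \<le> D"
  proof (cases "j \<le> 1")
    case True
    then show ?thesis using assms(2) by (cases j) auto
  next
    case False
    then obtain i where i: "j = Suc i" "i \<ge> 1" by (cases j) auto
    have "\<not> D \<le> i * U" using not_less_Least[of i "\<lambda>j. D \<le> j * U"] i j_def by simp
    moreover have "i * (2 * L) \<le> i * U" using assms(1) by simp
    moreover have "L \<le> i * L" using i by simp
    moreover have "i * (2 * L) = 2 * (i * L)" "Suc i * L = L + i * L" by simp_all
    ultimately show ?thesis unfolding i(1) by linarith
  qed
  then show ?thesis using that jU jk by blast
qed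

text \<open>Subtracting \<open>z\<close> from every summand turns it into 0 or any number from
  \<open>c - z\<close> to \<open>q - z\<close>; \<open>multiple_between\<close> tells how many
  summands \<open>j\<close> should come from the interval.\<close>

lemma k_sum_point_interval:
  assumes "z \<in> S" and "{c..q} \<subseteq> S" and "z \<le> c" and "2 * c \<le> q"
    and "k * z + c \<le> D" and "D \<le> k * q"
  shows "k_sum S k D"
proof -
  have "2 * (c - z) \<le> q - z" "c - z \<le> D - k * z" using assms by auto
  moreover have "D - k * z \<le> k * (q - z)" using assms by (simp add: diff_mult_distrib2)
  ultimately obtain j where j: "j \<le> k" "j * (c - z) \<le> D - k * z" "D - k * z \<le> j * (q - z)"
    by (rule multiple_between)
  have eq: "(k - j) * z + j * z = k * z"
    using j(1) by (metis distrib_right le_add_diff_inverse2)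
  have jz: "j * (c - z) = j * c - j * z" "j * (q - z) = j * q - j * z" "j * z \<le> j * c" "j * z \<le> j * q"
    using assms by (auto simp: diff_mult_distrib2)
  have le: "(k - j) * z \<le> D" using eq assms(5) by linarith
  have "k_sum S ((k - j) + j) ((k - j) * z + (D - (k - j) * z))"
  proof (intro k_sum_add k_sum_replicate assms(1) k_sum_interval[OF assms(2)])
    show "j * c \<le> D - (k - j) * z" using j(2) jz eq assms(5) by linarith
    show "D - (k - j) * z \<le> j * q" using j(3) jz eq assms(5) by linarith
  qed
  then show ?thesis using j(1) le by simp
qed

text \<open>Pairs 1 + 3 have mean 2. If \<open>y\<close> is odd, one triple 1 + 1 + 4, also of mean
  2, corrects the parity.\<close>

lemma k_sum_double:
  assumes "1 \<in> S" and "3 \<in> S" and "4 \<in> S \<or> even y" and "y \<ge> 2"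
  shows "k_sum S y (2 * y)"
proof (cases "even y")
  case True
  then obtain h where h: "y = 2 * h" by blast
  have "k_sum S (2 * h) (2 * h * 1 + h * 2)"
    using assms by (intro k_sum_two_values) (auto simp: numeral_3_eq_3)
  then show ?thesis using h by simp
next
  case False
  then have "y \<ge> 3" "even (y - 3)" using assms(4) by (auto simp: le_less)
  then obtain h where h: "y = 2 * h + 3" by (metis evenE le_add_diff_inverse2)
  have 1: "k_sum S (2 * h) (2 * h * 1 + h * 2)"
    using assms by (intro k_sum_two_values) (auto simp: numeral_3_eq_3)
  have "k_sum S 3 (3 * 1 + 1 * 3)"
    using assms False by (intro k_sum_two_values) auto
  from k_sum_add[OF 1 this] show ?thesis using h by (simp add: algebra_simps)
qed

section \<open>Upper bound: a colouring without monochromatic solution is contradictory\<close>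

context
  fixes a k c C :: nat and R B :: "nat set"
  assumes a: "3 \<le> a" and k: "a * (a - 1) \<le> k"
    and c: "k \<le> a * c" "a * c < k + a"
    and C: "k * c \<le> a * C" "a * C < k * c + a"
    and RB: "R \<union> B = {1..C}" and disj: "R \<inter> B = {}" and one: "1 \<in> R"
    and R: "\<And>y. y \<in> R \<Longrightarrow> \<not> k_sum R k (a * y)"
    and B: "\<And>y. y \<in> B \<Longrightarrow> \<not> k_sum B k (a * y)"
begin

lemma k_ge: "2 * a \<le> k"
proof -
  have "a * 2 \<le> a * (a - 1)" using a by (intro mult_le_mono) auto
  then show ?thesis using k by linarith
qed

lemma c_ge: "a - 1 \<le> c"
proof -
  have "a * (a - 1) \<le> a * c" using k c by linarith
  then show ?thesis using a by simp
qed

lemma C_ge: "2 * c \<le> C"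
proof -
  have "(2 * a) * c \<le> k * c" using k_ge by (rule mult_le_mono1)
  moreover have "a * (2 * c) = (2 * a) * c" by simp
  ultimately have "a * (2 * c) \<le> a * C" using C by linarith
  then show ?thesis using a by (simp only: mult_le_cancel1)
qed

text \<open>Serves to place candidates near \<open>k - a\<close> inside \<open>{1..C}\<close>:
  \<open>c \<ge> a\<close> gives \<open>C \<ge> k\<close>, and \<open>c = a - 1\<close> leaves only
  the least admissible \<open>k\<close>.\<close>

lemma boundary_case: "k = a * (a - 1) \<and> c = a - 1 \<or> k \<le> C"
proof (cases "a \<le> c")
  case True
  then have "a * k \<le> k * c" by simp
  then have "a * k \<le> a * C" using C by linarith
  then show ?thesis using a by simp
next
  case False
  then have "c = a - 1" using c_ge by simp
  then show ?thesis using k c by simp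
qed

lemma in_B_if_k_sum_R: "y \<in> {1..C} \<Longrightarrow> i \<le> a \<Longrightarrow> k_sum R (k - a + i) (i * y) \<Longrightarrow> y \<in> B"
  using k_sum_self[of y R i a k] R[of y] k_ge RB by (cases "y \<in> R") auto

lemma not_both: "y \<in> {1..C} \<Longrightarrow> i \<le> a \<Longrightarrow> j \<le> a \<Longrightarrow>
    k_sum R (k - a + i) (i * y) \<Longrightarrow> k_sum B (k - a + j) (j * y) \<Longrightarrow> False"
  using in_B_if_k_sum_R[of y i] B[of y] k_sum_self[of y B j a k] k_ge by simp

lemma blue_2_3: "2 \<in> B \<Longrightarrow> 3 \<in> B \<Longrightarrow> False"
proof -
  assume 23: "2 \<in> B" "3 \<in> B"
  let ?y = "k - a + 1"
  have "?y \<in> {1..C}"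
    using boundary_case
  proof
    assume eq: "k = a * (a - 1) \<and> c = a - 1"
    \<comment> \<open>At the boundary \<open>k * c / a\<close> is the square of
      \<open>a - 1\<close>, which is exactly \<open>k - a + 1\<close>.\<close>
    then have "k * c = a * ((a - 1) * (a - 1))" by simp
    then have "a * ((a - 1) * (a - 1)) \<le> a * C" using C by simp
    then have "(a - 1) * (a - 1) \<le> C" using a by simp
    moreover have "k - a + 1 = (a - 1) * (a - 1)" using eq a
      by (cases a) (auto simp: algebra_simps)
    ultimately show ?thesis by (metis atLeastAtMost_iff le_add2)
  next
    assume "k \<le> C"
    then show ?thesis using a k_ge by simp
  qed
  moreover have "k_sum R ?y (1 * ?y)" using k_sum_replicate[OF one, of ?y] by simp
  \<comment> \<open>Two in place of three would just fail, as \<open>2 * (k - a + 2)\<close> exceeds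
    \<open>2 * ?y\<close>; three suffices since \<open>k - a \<ge> 3\<close>.\<close>
  moreover have "k_sum B (k - a + 3) (3 * ?y)"
  proof (rule k_sum_interval)
    show "{2..3} \<subseteq> B" using 23 by (auto simp: le_Suc_eq numeral_eq_Suc)
  qed (use k_ge a in auto)
  ultimately show False using not_both[of ?y 1 3] a by auto
qed

lemma c_ge_2: "2 \<le> c" using c_ge a by simp

lemma red_3_blue_4: "2 \<in> B \<Longrightarrow> 3 \<in> R \<Longrightarrow> 4 \<in> B \<Longrightarrow> False"
proof -
  assume as: "2 \<in> B" "3 \<in> R" "4 \<in> B"
  have mem: "2 * c \<in> {1..C}" using C_ge c_ge_2 by simp
  have "k_sum B k (k * 2 + (a * c - k) * 2)"
    using as c k_ge by (intro k_sum_two_values) auto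
  then have b: "k_sum B (k - a + a) (a * (2 * c))"
    using c k_ge by (simp add: algebra_simps)
  show False
  proof (cases "even k")
    case True
    have "k_sum R k (k * 1 + (a * c - k div 2) * 2)"
      using as one c k_ge a by (intro k_sum_two_values) (auto simp: numeral_3_eq_3)
    moreover have "k * 1 + (a * c - k div 2) * 2 = a * (2 * c)"
      using True c by (auto elim!: evenE)
    ultimately show False using not_both[of "2 * c" a a] mem b k_ge by simp
  next
    case False
    then obtain h where h: "k = 2 * h + 1" by (rule oddE)
    \<comment> \<open>A sum of \<open>2 * h\<close> ones and threes equals
      \<open>2 * (a - 1) * c\<close> if \<open>(a - 1) * c - h\<close> of them are threes; the next
      bounds put this count between 0 and \<open>2 * h\<close>.\<close>
    have ac: "a * c = (a - 1) * c + c" using a by (cases a) auto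
    have "1 * c \<le> (a - 1) * c" using a by (intro mult_le_mono1) simp
    then have le: "h \<le> (a - 1) * c" using ac c h by linarith
    have "(a - 1) * c \<le> 3 * h" using ac c h k_ge c_ge_2 a by linarith
    then have "k_sum R (k - 1) ((k - 1) * 1 + ((a - 1) * c - h) * 2)"
      using as one h by (intro k_sum_two_values) (auto simp: numeral_3_eq_3)
    moreover have "(k - 1) * 1 + ((a - 1) * c - h) * 2 = (a - 1) * (2 * c)"
      using le h by simp
    moreover have "k - 1 = k - a + (a - 1)" using k_ge a by simp
    ultimately show False using not_both[of "2 * c" "a - 1" a] mem b by simp
  qed
qed

lemma red_3_4: "2 \<in> B \<Longrightarrow> 3 \<in> R \<Longrightarrow> 4 \<in> R \<Longrightarrow> False"
proof -
  assume as: "2 \<in> B" "3 \<in> R" "4 \<in> R"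
  show False
    using boundary_case
  proof
    assume eq: "k = a * (a - 1) \<and> c = a - 1"
    \<comment> \<open>Here \<open>a * c = k\<close>, so the target is \<open>2 * k\<close>, a sum of
      \<open>k\<close> elements of mean 2 in either colour.\<close>
    have k2: "k - a + a = k" "a * (2 * c) = 2 * k" using k_ge eq by auto
    have "k_sum B k (k * 2)" "k_sum R k (2 * k)"
      using as one k_ge a by (auto intro: k_sum_replicate k_sum_double)
    then have "k_sum B (k - a + a) (a * (2 * c))" "k_sum R (k - a + a) (a * (2 * c))"
      unfolding k2 by (simp_all add: mult.commute)
    then show False using not_both[of "2 * c" a a] C_ge c_ge_2 by simp
  next
    assume "k \<le> C"
    then have mem: "k - a + 2 \<in> {1..C}" using a k_ge by auto
    have "k_sum B (k - a + 2) ((k - a + 2) * 2)" "k_sum R (k - a + 2) (2 * (k - a + 2))"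
      using as one by (intro k_sum_replicate k_sum_double; simp)+
    then show False
      using not_both[of "k - a + 2" 2 2] mem a by (simp add: mult.commute)
  qed
qed

text \<open>
  Let \<open>z = t + 1\<close> be the least blue number and \<open>s\<close> the least red number that is at least \<open>c\<close>.
  Taking \<open>x\<^sub>m = s\<close> and \<open>a - i\<close> further copies of \<open>s\<close>, the red numbers \<open>1, \<dots>, t\<close> give
  \<open>i s > t (k - a + i)\<close> by descent from \<open>i = a\<close> to \<open>i = 1\<close>. Then the blue numbers \<open>z\<close> and
  \<open>c, \<dots>, s - 1\<close> give a solution with \<open>x\<^sub>m = s - 1\<close>.
\<close>
lemma red_2: "2 \<in> R \<Longrightarrow> False"
proof -
  assume two: "2 \<in> R"
  have "c \<in> B"
  proof (rule in_B_if_k_sum_R[of c a])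
    have "{1..2} \<subseteq> R" using one two by (auto simp: le_Suc_eq numeral_eq_Suc)
    then have "k_sum R k (a * c)" using c k_ge by (intro k_sum_interval) auto
    then show "k_sum R (k - a + a) (a * c)" using k_ge by simp
  qed (use C_ge c_ge_2 in auto)
  then have cR: "c \<notin> R" using disj by blast
  \<comment> \<open>Otherwise \<open>C\<close> and all of \<open>{c..C}\<close> are blue, and
    \<open>a * C\<close> lies between \<open>k * c\<close> and \<open>k * (c + 1)\<close>, hence is
    a sum of copies of \<open>c\<close> and \<open>c + 1\<close>.\<close>
  have ex_red: "\<exists>s. c \<le> s \<and> s \<in> R"
  proof (rule ccontr)
    assume "\<not> ?thesis"
    then have sub: "{c..C} \<subseteq> B" using RB c_ge_2 by fastforce
    have "a * C \<le> k * (c + 1)" using C k_ge by simp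
    then have "k_sum B k (a * C)"
      using C C_ge c_ge_2 sub by (intro k_sum_interval[of c "c + 1"]) auto
    then show False using B[of C] sub C_ge c_ge_2 by (auto simp: subset_iff)
  qed
  define s where "s = (LEAST s. c \<le> s \<and> s \<in> R)"
  have s: "c \<le> s" "s \<in> R" using LeastI_ex[OF ex_red] unfolding s_def by auto
  have ltB: "{c..s - 1} \<subseteq> B"
  proof
    fix x assume x: "x \<in> {c..s - 1}"
    then have "x < s" using c_ge_2 s by auto
    then have "x \<notin> R" using not_less_Least[of x "\<lambda>s. c \<le> s \<and> s \<in> R"] x s_def by auto
    moreover have "s \<le> C" using s RB by auto
    then have "x \<in> {1..C}" using x c_ge_2 by auto
    ultimately show "x \<in> B" using RB by blast
  qed
  define z where "z = (LEAST z. z \<in> B)"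
  have zB: "z \<in> B" unfolding z_def using \<open>c \<in> B\<close> by (rule LeastI)
  have zc: "z \<le> c" unfolding z_def using \<open>c \<in> B\<close> by (rule Least_le)
  have red_below_z: "x \<in> R" if "1 \<le> x" "x < z" for x
  proof -
    have "x \<notin> B" using not_less_Least[of x "\<lambda>z. z \<in> B"] that z_def by auto
    moreover have "x \<in> {1..C}" using that zc C_ge by auto
    ultimately show ?thesis using RB by blast
  qed
  define t where "t = z - 1"
  have "z \<noteq> 1" "z \<noteq> 2" "z \<ge> 1" using one two zB disj RB by auto
  then have t: "z = t + 1" "2 \<le> t" unfolding t_def by auto
  have tR: "{1..t} \<subseteq> R" using red_below_z t by auto
  have large: "t * (k - a + i) < i * s" if "1 \<le> i" "i \<le> a" for i
    using that(2,1)
  proof (induction i rule: inc_induct)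
    case base
    have "k \<le> a * s" using c s(1) mult_le_mono2[of c s a] by linarith
    then have "\<not> a * s \<le> k * t"
      using R[OF s(2)] k_sum_interval[OF tR, of k "a * s"] by auto
    then show ?case using k_ge by (simp add: mult.commute)
  next
    case (step i)
    let ?e = "k - a + i"
    \<comment> \<open>With \<open>t \<ge> 2\<close>, the induction hypothesis yields
      \<open>?e \<le> i * s\<close>, so \<open>i * s\<close> can only miss the range of red sums at
      its upper end.\<close>
    have "2 * (k - a + Suc i) \<le> t * (k - a + Suc i)" using t(2) by (rule mult_le_mono1)
    then have "2 * ?e < Suc i * s" using step by simp
    also have "\<dots> \<le> (2 * i) * s" using step by (intro mult_le_mono1) simp
    finally have "?e \<le> i * s" by simp
    show ?case
    proof (rule ccontr)
      assume "\<not> ?thesis"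
      then have "k_sum R ?e (i * s)"
        using \<open>?e \<le> i * s\<close> by (intro k_sum_interval[OF tR]) (auto simp: mult.commute)
      then show False
        using R[OF s(2)] k_sum_self[OF s(2), of i a k] step k_ge by simp
    qed
  qed
  define q where "q = s - 1"
  have tq: "t * (k - a + 1) \<le> q" using large[of 1] a unfolding q_def by simp
  have cq: "{c..q} \<subseteq> B" using ltB q_def by simp
  have cs: "c < s" using cR s le_neq_implies_less by blast
  then have "q \<in> B" using cq q_def by auto
  \<comment> \<open>Expanded, this is the hypothesis \<open>a * (a - 1) \<le> k\<close>.\<close>
  have k_split: "(a - 1) * k \<le> a * (k - a + 1)"
  proof -
    obtain e where e: "k = a + e" using k_ge le_Suc_ex[of a k] by auto
    obtain b where b: "a = Suc b" using a by (cases a) auto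
    show ?thesis using k unfolding e b by (simp add: algebra_simps)
  qed
  \<comment> \<open>The aim is
    \<open>a * q \<ge> 2 * t * k \<ge> t * k + 2 * k \<ge> k * z + c\<close>, the lower bound needed
    for a sum of \<open>z\<close> and interval elements.\<close>
  have "2 * (t * k) \<le> (a - 1) * (t * k)" using a by (intro mult_le_mono1) simp
  also have "\<dots> = t * ((a - 1) * k)" by simp
  also have "\<dots> \<le> t * (a * (k - a + 1))" using k_split by (rule mult_le_mono2)
  also have "\<dots> = a * (t * (k - a + 1))" by (rule mult.left_commute)
  also have "\<dots> \<le> a * q" using tq by (rule mult_le_mono2)
  finally have aq: "2 * (t * k) \<le> a * q" .
  have "2 * k \<le> t * k" using t by simp
  have ck: "c \<le> k" using c a k_ge mult_le_mono1[of 3 a c] by linarith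
  have "2 * (k - a + 1) \<le> t * (k - a + 1)" using t(2) by (rule mult_le_mono1)
  then have "2 * (k - a + 1) \<le> q" using tq by linarith
  moreover have "c \<le> k - a + 1"
    using c a k_ge mult_le_mono1[of 3 a c] by linarith
  ultimately have "2 * c \<le> q" by (meson le_trans mult_le_mono2)
  then have "k_sum B k (a * q)"
  proof (rule k_sum_point_interval[OF zB cq zc])
    have "k * z = t * k + k" using t by simp
    then show "k * z + c \<le> a * q" using aq \<open>2 * k \<le> t * k\<close> ck by linarith
    show "a * q \<le> k * q" using k_ge by simp
  qed
  then show False using B \<open>q \<in> B\<close> by blast
qed

lemma coloring_impossible: False
proof -
  have "{2, 3, 4} \<subseteq> R \<union> B" using RB C_ge c_ge_2 by auto
  then show False using red_2 blue_2_3 red_3_blue_4 red_3_4 by blast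
qed

end

section \<open>The nested ceilings, the lower bound and the conclusion\<close>

text \<open>Trades the real ceilings for inequalities in natural numbers that determine them;
  \<open>c\<close> is the inner ceiling.\<close>

lemma rado_C_bounds:
  assumes "a \<ge> 1" and "m \<ge> 1"
  obtains c where "m - 1 \<le> a * c" "a * c < m - 1 + a"
    "(m - 1) * c \<le> a * rado_C m a" "a * rado_C m a < (m - 1) * c + a"
proof -
  have ceil: "\<exists>c. \<lceil>real u / real a\<rceil> = int c \<and> u \<le> a * c \<and> a * c < u + a" for u
  proof -
    define c where "c = nat \<lceil>real u / real a\<rceil>"
    have "0 \<le> \<lceil>real u / real a\<rceil>" by (rule order_trans[OF _ ceiling_mono[of 0]]) simp_all
    then have c: "\<lceil>real u / real a\<rceil> = int c" unfolding c_def by simp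
    then have "real c - 1 < real u / real a" "real u / real a \<le> real c"
      using ceiling_correct[of "real u / real a"] by auto
    then have "real a * real c < real u + real a" "real u \<le> real a * real c"
      using assms by (auto simp: field_simps)
    then have "real (a * c) < real (u + a)" "real u \<le> real (a * c)" by simp_all
    then show ?thesis using c by (auto simp only: of_nat_less_iff of_nat_le_iff)
  qed
  obtain c where c: "\<lceil>real (m - 1) / real a\<rceil> = int c" "m - 1 \<le> a * c" "a * c < m - 1 + a"
    using ceil by blast
  have eq: "(real m - 1) / real a * real_of_int \<lceil>(real m - 1) / real a\<rceil>
      = real ((m - 1) * c) / real a"
    using c(1) assms by (simp add: of_nat_diff)
  obtain C where C: "\<lceil>real ((m - 1) * c) / real a\<rceil> = int C" "(m - 1) * c \<le> a * C"
    "a * C < (m - 1) * c + a"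
    using ceil by blast
  have "rado_C m a = C" unfolding rado_C_def eq using C(1) by simp
  then show ?thesis using that c C by blast
qed

text \<open>A solution below \<open>c\<close> would give
  \<open>m - 1 \<le> a * x m \<le> a * (c - 1) < m - 1\<close>; one from \<open>c\<close> on would
  give \<open>(m - 1) * c \<le> a * x m \<le> a * n\<close>.\<close>

lemma threshold_coloring:
  assumes a: "a \<ge> 1" and m: "m \<ge> 2" and c: "a * c < m - 1 + a" and n: "a * n < (m - 1) * c"
  shows "\<not> has_mono_solution m a n (\<lambda>x. x < c)"
proof
  assume "has_mono_solution m a n (\<lambda>x. x < c)"
  then obtain x where x: "\<forall>i \<in> {1..m}. x i \<in> {1..n}"
    and same: "\<forall>i \<in> {1..m}. \<forall>j \<in> {1..m}. (x i < c) = (x j < c)"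
    and sum: "(\<Sum>i = 1..m - 1. x i) = a * x m"
    unfolding has_mono_solution_def by blast
  have col: "(x i < c) = (x m < c)" if "i \<in> {1..m}" for i
    using same that m by (meson atLeastAtMost_iff le_refl le_trans)
  have bound: "(m - 1) * d \<le> a * x m" if "\<And>i. i \<in> {1..m} \<Longrightarrow> d \<le> x i" for d
  proof -
    have "of_nat (card {1..m - 1}) * d \<le> (\<Sum>i = 1..m - 1. x i)"
      using that by (intro sum_bounded_below) auto
    then show ?thesis using sum by simp
  qed
  show False
  proof (cases "x m < c")
    case True
    then have "a * (x m + 1) \<le> a * c" by (intro mult_le_mono2) simp
    moreover have "(m - 1) * 1 \<le> a * x m" using x by (intro bound) auto
    ultimately show False using c by simp
  next
    case False
    then have "(m - 1) * c \<le> a * x m" using col by (intro bound) (meson not_less)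
    moreover have "a * x m \<le> a * n" using x m by (intro mult_le_mono2) auto
    ultimately show False using n by linarith
  qed
qed

theorem theorem1:
  fixes a m :: nat
  assumes "a \<ge> 3" and "m \<ge> a\<^sup>2 - a + 1"
  shows "is_rado_number m a (rado_C m a)"
proof -
  have k: "a * (a - 1) \<le> m - 1"
    using assms(2) by (simp add: power2_eq_square diff_mult_distrib2)
  have "3 * 2 \<le> a * (a - 1)" using assms(1) by (intro mult_le_mono) auto
  then have m: "m \<ge> 2" using k by linarith
  define C where "C = rado_C m a"
  obtain c where c: "m - 1 \<le> a * c" "a * c < m - 1 + a"
    and C: "(m - 1) * c \<le> a * C" "a * C < (m - 1) * c + a"
    using rado_C_bounds[of a m] assms(1) m unfolding C_def by auto
  have "c > 0" using c(1) m by (cases c) auto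
  then have "C > 0" using C(1) m by (cases C) auto
  moreover have "forces_solution m a C"
    unfolding forces_solution_def
  proof
    fix col
    show "has_mono_solution m a C col"
    proof (rule ccontr)
      assume no: "\<not> ?thesis"
      let ?S = "\<lambda>b. {x \<in> {1..C}. col x = b}"
      have S: "\<not> k_sum (?S b) (m - 1) (a * y)" if "y \<in> ?S b" for b y
      proof
        assume "k_sum (?S b) (m - 1) (a * y)"
        then have "has_mono_solution m a C col"
          by (rule has_mono_solutionI[where b = b, rotated]) (use that m in auto)
        then show False using no by blast
      qed
      show False
      \<comment> \<open>Red is the colour of 1, whichever truth value that is.\<close>
      proof (rule coloring_impossible[OF assms(1) k c C, of "?S (col 1)" "?S (\<not> col 1)"])
        show "?S (col 1) \<union> ?S (\<not> col 1) = {1..C}" by auto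
        show "?S (col 1) \<inter> ?S (\<not> col 1) = {}" by auto
        show "1 \<in> ?S (col 1)" using \<open>C > 0\<close> by simp
      qed (fact S)+
    qed
  qed
  moreover have "C \<le> n" if "forces_solution m a n" for n
  proof (rule ccontr)
    assume "\<not> ?thesis"
    then have "a * (n + 1) \<le> a * C" by (intro mult_le_mono2) simp
    then have "a * n < (m - 1) * c" using C(2) by simp
    then show False
      using threshold_coloring[of a m c n] assms(1) m c(2) that unfolding forces_solution_def by auto
  qed
  ultimately show ?thesis unfolding is_rado_number_def C_def by auto
qed

end
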